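(* Let $S^t:X\to X$ be a Lipschitz continuous measure-preserving flow on a compact metric space $X\subseteq\mathbb{R}^N$, preserving the absolutely continuous measure $\mu$ with $\operatorname{supp}\mu=X$. Let $\{\tau(n)\}_{n\ge1}$ be the time steps and $\{\mathcal{P}_n\}_{n\ge 1}$ the sequence of partitions described in the context, with $\operatorname{diam}(p_{n,j})\le l(n)$ for all $n$ and $j$. If $$\lim_{n\to\infty}\frac{l(n)}{\tau(n)}=0,$$ then there exists a sequence of periodic approximations $\{S^{\tau(n)}_n:\mathcal{P}_n\to\mathcal{P}_n\}_{n=1}^\infty$ such that $$\lim_{n\to\infty}\int_{-t}^{t} d_H\left(S^{s}(A),\,S_n^{\xi_n(s)}(A_n)\right)\,\mathrm{d}s=0$$ for every fixed $t\in\mathbb{R}$ and every nonempty compact set $A\subseteq X$.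
   Context: Setting. $X\subseteq\mathbb{R}^N$ is compact, with metric $d$ induced by a norm on $\mathbb{R}^N$. $S^t:X\to X$, $t\in\mathbb{R}$, is a flow: $S^t\circ S^s=S^{t+s}$ and $S^0=\mathrm{id}$. It is Lipschitz continuous: for every $T>0$ the map $(t,x)\mapsto S^t(x)$ is Lipschitz on $[-T,T]\times X$. $\mu$ is a finite nonzero Borel measure on $X$, absolutely continuous with respect to Lebesgue measure, with $\operatorname{supp}\mu=X$, and invariant: $\mu(S^t(B))=\mu(B)$ for all Borel $B\subseteq X$ and $t\in\mathbb{R}$. Time steps. $\{\tau(n)\}_{n\ge1}$ is a monotonically decreasing sequence of positive reals converging to $0$. Put $$\xi_n(s)=\operatorname{sign}(s)\left\lceil\frac{|s|}{\tau(n)}\right\rceil\tau(n),\qquad s\in\mathbb{R}.$$ Partitions. $\mathcal{P}_n=\{p_{n,1},\dots,p_{n,q(n)}\}$, $n\ge1$, are measurable partitions of $X$ (the elements cover $X$ and distinct elements overlap only in $\mu$-null sets) such that: (i) each $p_{n,j}$ is compact and connected, and $\mu(p_{n,j})=\mu(X)/q(n)$, where $q:\mathbb{N}\to\mathbb{N}$ is strictly increasing; (ii) $\operatorname{diam}(p_{n,j})=\sup_{x,y\in p_{n,j}}d(x,y)\le l(n)$, where $l:\mathbb{N}\to\mathbb{R}$ is positive, monotone, and tends to $0$; (iii) for $n>m$, $\mathcal{P}_n$ refines $\mathcal{P}_m$, i.e. each $p_{m,j}$ is a union of elements of $\mathcal{P}_n$. Periodic approximations. A periodic approximation $S_n^{\tau(n)}:\mathcal{P}_n\to\mathcal{P}_n$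 is a bijection (permutation) of the finite set $\mathcal{P}_n$. For $k\in\mathbb{Z}$, $S_n^{k\tau(n)}$ denotes its $k$-th iterate (inverse iterates for $k<0$). It acts on a union of elements of $\mathcal{P}_n$ elementwise: $S_n^{k\tau(n)}\big(\bigcup_i p_{n,j_i}\big)=\bigcup_i S_n^{k\tau(n)}(p_{n,j_i})$, viewed as a subset of $X$. Since $\xi_n(s)$ is an integer multiple of $\tau(n)$, $S_n^{\xi_n(s)}$ is well defined. For a set $A\subseteq X$, $A_n:=\bigcup\{p\in\mathcal{P}_n: p\cap A\neq\emptyset\}$. $d_H$ is the Hausdorff distance, $d_H(A,B)=\max\{\sup_{a\in A}\inf_{b\in B}d(a,b),\ \sup_{b\in B}\inf_{a\in A}d(a,b)\}$. *)

theory Defs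
  imports "HOL-Analysis.Analysis"
begin

section \<open>Metric notions for an arbitrary norm\<close>

text \<open>
  The metric comes from an arbitrary norm on Euclidean space, not necessarily the Euclidean one, so
  the metric notions below take the distance as a parameter. Topological and measure-theoretic
  notions (compact, connected, Borel) do not depend on the choice of norm and are the library's.
\<close>

definition is_norm :: "('a::real_vector \<Rightarrow> real) \<Rightarrow> bool" where
  "is_norm \<nu> \<longleftrightarrow>
     (\<forall>x. 0 \<le> \<nu> x) \<and> (\<forall>x. \<nu> x = 0 \<longleftrightarrow> x = 0) \<and>
     (\<forall>c x. \<nu> (c *\<^sub>R x) = \<bar>c\<bar> * \<nu> x) \<and> (\<forall>x y. \<nu> (x + y) \<le> \<nu> x + \<nu> y)"

definition norm_dist :: "('a::real_vector \<Rightarrow> real) \<Rightarrow> 'a \<Rightarrow> 'a \<Rightarrow> real" where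
  "norm_dist \<nu> x y = \<nu> (x - y)"

text \<open>Real-valued suprema and infima: meaningful for nonempty bounded sets only.\<close>

definition set_diam :: "('a \<Rightarrow> 'a \<Rightarrow> real) \<Rightarrow> 'a set \<Rightarrow> real" where
  "set_diam d A = (SUP (x, y)\<in>A \<times> A. d x y)"

definition hausdorff_distance :: "('a \<Rightarrow> 'a \<Rightarrow> real) \<Rightarrow> 'a set \<Rightarrow> 'a set \<Rightarrow> real" where
  "hausdorff_distance d A B =
     max (SUP a\<in>A. INF b\<in>B. d a b) (SUP b\<in>B. INF a\<in>A. d a b)"

section \<open>Measure-preserving Lipschitz flows\<close>

definition flow_on :: "'a set \<Rightarrow> (real \<Rightarrow> 'a \<Rightarrow> 'a) \<Rightarrow> bool" where
  "flow_on X S \<longleftrightarrow>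
     (\<forall>t. \<forall>x\<in>X. S t x \<in> X) \<and> (\<forall>x\<in>X. S 0 x = x) \<and>
     (\<forall>t s. \<forall>x\<in>X. S t (S s x) = S (t + s) x)"

text \<open>
  The product \<open>[-T, T] \<times> X\<close> carries the sum metric; any other standard product
  metric only changes the constant.
\<close>

definition lipschitz_flow :: "('a \<Rightarrow> 'a \<Rightarrow> real) \<Rightarrow> 'a set \<Rightarrow> (real \<Rightarrow> 'a \<Rightarrow> 'a) \<Rightarrow> bool" where
  "lipschitz_flow d X S \<longleftrightarrow>
     flow_on X S \<and>
     (\<forall>T>0. \<exists>L. \<forall>s\<in>{-T..T}. \<forall>t\<in>{-T..T}. \<forall>x\<in>X. \<forall>y\<in>X.
        d (S s x) (S t y) \<le> L * (\<bar>s - t\<bar> + d x y))"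

definition measure_support :: "'a::topological_space measure \<Rightarrow> 'a set" where
  "measure_support \<mu> =
     {x \<in> space \<mu>. \<forall>U. open U \<longrightarrow> x \<in> U \<longrightarrow> 0 < emeasure \<mu> (U \<inter> space \<mu>)}"

text \<open>
  A Borel measure on \<open>X\<close> is a measure on the trace of the Borel sigma-algebra, so that
  \<^term>\<open>space \<mu> = X\<close>.
\<close>

definition reference_measure :: "'a::euclidean_space set \<Rightarrow> 'a measure \<Rightarrow> bool" where
  "reference_measure X \<mu> \<longleftrightarrow>
     space \<mu> = X \<and> sets \<mu> = sets (restrict_space borel X) \<and>
     finite_measure \<mu> \<and> emeasure \<mu> X \<noteq> 0 \<and>
     absolutely_continuous (restrict_space lborel X) \<mu> \<and>
     measure_support \<mu> = X"

definition preserves_measure :: "(real \<Rightarrow> 'a \<Rightarrow> 'a) \<Rightarrow> 'a measure \<Rightarrow> bool" where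
  "preserves_measure S \<mu> \<longleftrightarrow> (\<forall>t. \<forall>B\<in>sets \<mu>. emeasure \<mu> (S t ` B) = emeasure \<mu> B)"

section \<open>Time steps and partitions\<close>

text \<open>All sequences are indexed by \<open>n \<ge> 1\<close>; values at \<open>0\<close> are unconstrained.\<close>

definition time_steps :: "(nat \<Rightarrow> real) \<Rightarrow> bool" where
  "time_steps \<tau> \<longleftrightarrow> (\<forall>n\<ge>1. 0 < \<tau> n) \<and> antimono_on {1..} \<tau> \<and> \<tau> \<longlonglongrightarrow> 0"

definition partition_sequence ::
  "('a::topological_space \<Rightarrow> 'a \<Rightarrow> real) \<Rightarrow> 'a set \<Rightarrow> 'a measure \<Rightarrow>
   (nat \<Rightarrow> nat) \<Rightarrow> (nat \<Rightarrow> real) \<Rightarrow> (nat \<Rightarrow> 'a set set) \<Rightarrow> bool" where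
  "partition_sequence d X \<mu> q l P \<longleftrightarrow>
     strict_mono_on {1..} q \<and>
     (\<forall>n\<ge>1. 0 < l n) \<and> (mono_on {1..} l \<or> antimono_on {1..} l) \<and> l \<longlonglongrightarrow> 0 \<and>
     (\<forall>n\<ge>1. finite (P n) \<and> card (P n) = q n \<and> \<Union>(P n) = X \<and>
        (\<forall>p\<in>P n. \<forall>p'\<in>P n. p \<noteq> p' \<longrightarrow> p \<inter> p' \<in> null_sets \<mu>) \<and>
        (\<forall>p\<in>P n. compact p \<and> connected p \<and>
           measure \<mu> p = measure \<mu> X / real (q n) \<and> set_diam d p \<le> l n)) \<and>
     (\<forall>m\<ge>1. \<forall>n>m. \<forall>p\<in>P m. \<exists>Q\<subseteq>P n. p = \<Union>Q)"

section \<open>Periodic approximations\<close>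

definition periodic_approximation :: "'a set set \<Rightarrow> ('a set \<Rightarrow> 'a set) \<Rightarrow> bool" where
  "periodic_approximation P \<sigma> \<longleftrightarrow> bij_betw \<sigma> P P"

definition iterate :: "'b set \<Rightarrow> ('b \<Rightarrow> 'b) \<Rightarrow> int \<Rightarrow> 'b \<Rightarrow> 'b" where
  "iterate P \<sigma> k =
     (if 0 \<le> k then \<sigma> ^^ nat k else inv_into P \<sigma> ^^ nat (- k))"

text \<open>
  A union of partition elements is represented by the family of the elements in the union. This
  family is determined by the union, as the elements have positive measure and null overlaps.
\<close>

definition iterate_union :: "'a set set \<Rightarrow> ('a set \<Rightarrow> 'a set) \<Rightarrow> int \<Rightarrow> 'a set set \<Rightarrow> 'a set" where
  "iterate_union P \<sigma> k Q = \<Union>(iterate P \<sigma> k ` Q)"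

text \<open>The set \<open>A\<^sub>n\<close> is the union of \<open>cells_meeting (P n) A\<close>.\<close>

definition cells_meeting :: "'a set set \<Rightarrow> 'a set \<Rightarrow> 'a set set" where
  "cells_meeting P A = {p \<in> P. p \<inter> A \<noteq> {}}"

text \<open>
  The integer \<open>k\<close> with \<open>\<xi>\<^sub>n(s) = k \<tau>(n)\<close>, where \<open>h = \<tau>(n)\<close>.
\<close>

definition xi_steps :: "real \<Rightarrow> real \<Rightarrow> int" where
  "xi_steps h s = (if s < 0 then - \<lceil>\<bar>s\<bar> / h\<rceil> else \<lceil>\<bar>s\<bar> / h\<rceil>)"

lemma xi_steps_times_step:
  "real_of_int (xi_steps h s) * h = sgn s * real_of_int \<lceil>\<bar>s\<bar> / h\<rceil> * h"
  by (auto simp: xi_steps_def sgn_if)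

end

theory Submission
  imports Defs
begin

text \<open>
  A permutation \<open>\<sigma>\<close> of the cells such that \<open>\<sigma> p\<close> always meets \<open>S (\<tau> n) ` p\<close> exists by Hall's marriage
  theorem. Following a point of \<open>p\<close> for \<open>k\<close> steps, the replacement of one point of a cell by another
  one costs at most \<open>L * l n\<close> per step, so for \<open>k \<le> T / \<tau> n\<close> the orbit of cells stays within
  \<open>O(l n / \<tau> n + l n)\<close> of the true orbit. The Hausdorff distance therefore tends to \<open>0\<close> uniformly on
  bounded time intervals.
\<close>

section \<open>Hall's marriage theorem and permutations of cells of equal mass\<close>

text \<open>Halmos-Vaughan induction on \<open>A\<close>. Either some nonempty proper subset is
  tight, having exactly as many neighbours as elements, and the problem splits along it; or every
  such subset has a spare neighbour, and one element can be matched freely.\<close>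

lemma hall_marriage:
  fixes N :: "'a \<Rightarrow> 'b set"
  assumes "finite A"
    and "\<And>a. a \<in> A \<Longrightarrow> finite (N a)"
    and "\<And>F. F \<subseteq> A \<Longrightarrow> card F \<le> card (\<Union>a\<in>F. N a)"
  shows "\<exists>f. inj_on f A \<and> (\<forall>a\<in>A. f a \<in> N a)"
  using assms
proof (induction A arbitrary: N rule: finite_psubset_induct)
  case (psubset A N)
  have fin_N: "finite (\<Union>a\<in>F. N a)" if "F \<subseteq> A" for F
    using that psubset.hyps psubset.prems(1) by (auto intro: finite_subset)
  consider "A = {}"
    | F where "F \<subset> A" "F \<noteq> {}" "card (\<Union>a\<in>F. N a) = card F"
    | "A \<noteq> {}" "\<And>F. F \<subset> A \<Longrightarrow> F \<noteq> {} \<Longrightarrow> card F < card (\<Union>a\<in>F. N a)"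
    using psubset.prems(2) by (metis le_neq_implies_less psubset_imp_subset)
  then show ?case
  proof cases
    case 1
    then show ?thesis by simp
  next
    case (2 F)
    let ?U = "\<Union>a\<in>F. N a"
    have "\<exists>f. inj_on f F \<and> (\<forall>a\<in>F. f a \<in> N a)"
      using 2(1) psubset.prems by (intro psubset.IH) auto
    then obtain f where f: "inj_on f F" "\<And>a. a \<in> F \<Longrightarrow> f a \<in> N a" by blast
    \<comment> \<open>Hall's condition survives outside \<open>F\<close> after deleting the
      neighbours of \<open>F\<close>: apply it to \<open>G \<union> F\<close> and subtract the tight
      equality for \<open>F\<close>. The deletion also keeps the values of \<open>g\<close> apart
      from those of \<open>f\<close>.\<close>
    have "\<exists>g. inj_on g (A - F) \<and> (\<forall>a\<in>A - F. g a \<in> N a - ?U)"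
    proof (rule psubset.IH)
      fix G assume G: "G \<subseteq> A - F"
      have fin: "finite G" "finite F"
        using G 2(1) psubset.hyps by (auto intro: finite_subset)
      have "card G + card F = card (G \<union> F)"
        using G fin by (subst card_Un_disjoint) auto
      also have "\<dots> \<le> card (\<Union>a\<in>G \<union> F. N a)"
        using G 2(1) by (intro psubset.prems(2)) auto
      also have "(\<Union>a\<in>G \<union> F. N a) = (\<Union>a\<in>G. N a - ?U) \<union> ?U" by auto
      also have "card \<dots> \<le> card (\<Union>a\<in>G. N a - ?U) + card ?U" by (rule card_Un_le)
      finally show "card G \<le> card (\<Union>a\<in>G. N a - ?U)" using 2(3) by simp
    qed (use 2 psubset.prems in auto)
    then obtain g where g: "inj_on g (A - F)" "\<And>a. a \<in> A - F \<Longrightarrow> g a \<in> N a - ?U" by blast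
    let ?h = "\<lambda>a. if a \<in> F then f a else g a"
    have "inj_on ?h A"
    proof (rule inj_onI)
      fix a b assume *: "a \<in> A" "b \<in> A" "?h a = ?h b"
      show "a = b"
        using * f g(2)[of a] g(2)[of b] inj_onD[OF f(1)] inj_onD[OF g(1)]
        by (auto split: if_splits) (metis)+
    qed
    moreover have "\<forall>a\<in>A. ?h a \<in> N a" using f g by auto
    ultimately show ?thesis by blast
  next
    case 3
    then obtain a where a: "a \<in> A" by blast
    have "card {a} \<le> card (\<Union>b\<in>{a}. N b)" using a by (intro psubset.prems(2)) auto
    then obtain y where y: "y \<in> N a" by fastforce
    \<comment> \<open>Deleting the value \<open>y\<close> costs a set of neighbours at most one
      element, which the strict inequality for nonempty proper subsets absorbs.\<close>
    have "\<exists>g. inj_on g (A - {a}) \<and> (\<forall>b\<in>A - {a}. g b \<in> N b - {y})"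
    proof (rule psubset.IH)
      fix G assume G: "G \<subseteq> A - {a}"
      show "card G \<le> card (\<Union>b\<in>G. N b - {y})"
      proof (cases "G = {}")
        case False
        then have "card G < card (\<Union>b\<in>G. N b)" using G a by (intro 3(2)) auto
        moreover have "(\<Union>b\<in>G. N b - {y}) = (\<Union>b\<in>G. N b) - {y}" by auto
        moreover have "finite (\<Union>b\<in>G. N b)" using G by (intro fin_N) auto
        ultimately show ?thesis by (auto simp: card_Diff_singleton_if)
      qed simp
    qed (use a psubset.prems in auto)
    then obtain g where g: "inj_on g (A - {a})" "\<And>b. b \<in> A - {a} \<Longrightarrow> g b \<in> N b - {y}" by blast
    have "inj_on (g(a := y)) (insert a (A - {a}))"
      using g by (subst inj_on_insert) (force simp: inj_on_def)
    then have "inj_on (g(a := y)) A" using a by (simp add: insert_absorb)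
    moreover have "\<forall>b\<in>A. (g(a := y)) b \<in> N b" using g(2) y by auto
    ultimately show ?thesis by blast
  qed
qed

text \<open>
  Hall's condition holds because the image of a union of \<open>k\<close> cells has the mass of \<open>k\<close> cells and
  therefore cannot be covered by fewer than \<open>k\<close> of them.
\<close>

lemma (in finite_measure) ex_permutation_of_equal_cells:
  fixes f :: "'a \<Rightarrow> 'a"
  assumes "finite P" "P \<subseteq> sets M" "\<Union>P = space M"
    and null: "\<And>p p'. p \<in> P \<Longrightarrow> p' \<in> P \<Longrightarrow> p \<noteq> p' \<Longrightarrow> p \<inter> p' \<in> null_sets M"
    and mass: "\<And>p. p \<in> P \<Longrightarrow> measure M p = c" and "0 < c"
    and f: "f \<in> space M \<rightarrow> space M"
    and inv: "\<And>B. B \<in> sets M \<Longrightarrow> emeasure M (f ` B) = emeasure M B"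
  shows "\<exists>\<sigma>. bij_betw \<sigma> P P \<and> (\<forall>p\<in>P. \<exists>x\<in>p. f x \<in> \<sigma> p)"
proof -
  define N where "N p = {p' \<in> P. f ` p \<inter> p' \<noteq> {}}" for p
  \<comment> \<open>Null overlaps make masses add up, so the mass of a union of cells counts its
    cells.\<close>
  have union: "\<Union>F \<in> sets M \<and> emeasure M (\<Union>F) = ennreal (real (card F) * c)" if "F \<subseteq> P" for F
  proof -
    have "finite F" using that assms(1) finite_subset by blast
    moreover have "pairwise (\<lambda>p p'. AE x in M. x \<notin> p \<or> x \<notin> p') F"
    proof (rule pairwiseI)
      fix p p' assume "p \<in> F" "p' \<in> F" "p \<noteq> p'"
      then have "AE x in M. x \<notin> p \<inter> p'" using null that by (intro AE_not_in) auto
      then show "AE x in M. x \<notin> p \<or> x \<notin> p'" by simp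
    qed
    ultimately have "measure M (\<Union>F) = (\<Sum>p\<in>F. measure M p)"
      using that assms(2) by (intro measure_Union_AE) (auto simp: fmeasurable_eq_sets)
    also have "\<dots> = real (card F) * c" using that mass by (simp add: subset_iff)
    finally have "measure M (\<Union>F) = real (card F) * c" .
    moreover have "\<Union>F \<in> sets M"
      using \<open>finite F\<close> that assms(2) by (intro sets.finite_Union) auto
    ultimately show ?thesis by (simp add: emeasure_eq_measure)
  qed
  have "\<exists>\<sigma>. inj_on \<sigma> P \<and> (\<forall>p\<in>P. \<sigma> p \<in> N p)"
  proof (rule hall_marriage)
    fix F assume F: "F \<subseteq> P"
    let ?G = "\<Union>p\<in>F. N p"
    have G: "?G \<subseteq> P" by (auto simp: N_def)
    have "f ` \<Union>F \<subseteq> \<Union>?G"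
    proof
      fix y assume "y \<in> f ` \<Union>F"
      then obtain p x where px: "p \<in> F" "x \<in> p" "y = f x" by blast
      then have "x \<in> space M" using F assms(3) by blast
      then have "y \<in> \<Union>P" using f px assms(3) by auto
      then obtain p' where "p' \<in> P" "y \<in> p'" by blast
      then show "y \<in> \<Union>?G" using px by (auto simp: N_def)
    qed
    \<comment> \<open>Monotonicity asks for measurability of the larger set only, which is a finite
      union of cells; the mass of the image comes from \<open>inv\<close>.\<close>
    then have "emeasure M (f ` \<Union>F) \<le> emeasure M (\<Union>?G)"
      using union[OF G] by (intro emeasure_mono) auto
    then have "ennreal (real (card F) * c) \<le> ennreal (real (card ?G) * c)"
      using union[OF G] union[OF F] inv[of "\<Union>F"] by simp
    then show "card F \<le> card ?G" using \<open>0 < c\<close> by (simp add: ennreal_le_iff)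
  qed (use assms(1) in \<open>auto simp: N_def\<close>)
  then obtain \<sigma> where \<sigma>: "inj_on \<sigma> P" "\<And>p. p \<in> P \<Longrightarrow> \<sigma> p \<in> N p" by blast
  then have "\<sigma> ` P \<subseteq> P" by (auto simp: N_def)
  then have "bij_betw \<sigma> P P"
    using \<sigma>(1) assms(1) by (simp add: bij_betw_def endo_inj_surj)
  moreover have "\<forall>p\<in>P. \<exists>x\<in>p. f x \<in> \<sigma> p" using \<sigma>(2) by (fastforce simp: N_def)
  ultimately show ?thesis by blast
qed

section \<open>Hausdorff distance over an arbitrary distance function\<close>

text \<open>Nonnegativity of \<open>d\<close> bounds the inner infima from below and
  \<open>e\<close> bounds the outer suprema from above, so the real-valued extrema are genuine. The
  absolute value is the form needed for estimating integrals.\<close>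

lemma hausdorff_distance_abs_le:
  assumes "A \<noteq> {}" "B \<noteq> {}" and nonneg: "\<And>x y. 0 \<le> d x y"
    and AB: "\<And>a. a \<in> A \<Longrightarrow> \<exists>b\<in>B. d a b \<le> e"
    and BA: "\<And>b. b \<in> B \<Longrightarrow> \<exists>a\<in>A. d a b \<le> e"
  shows "\<bar>hausdorff_distance d A B\<bar> \<le> e"
proof -
  have bdd: "bdd_below (f ` C)" if "\<And>x. 0 \<le> f x" for f :: "_ \<Rightarrow> real" and C
    using that by (auto intro: bdd_belowI[of _ 0])
  have 1: "(INF b\<in>B. d a b) \<le> e" if "a \<in> A" for a
    using AB[OF that] cINF_lower2[OF bdd] nonneg by metis
  have 2: "(INF a\<in>A. d a b) \<le> e" if "b \<in> B" for b
    using BA[OF that] cINF_lower2[OF bdd] nonneg by metis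
  \<comment> \<open>One point of \<open>A\<close> suffices for nonnegativity: its infimum lies
    between 0 and the supremum.\<close>
  obtain a where a: "a \<in> A" using assms(1) by blast
  have "0 \<le> (INF b\<in>B. d a b)" using assms(2) nonneg by (intro cINF_greatest) auto
  also have "\<dots> \<le> (SUP a\<in>A. INF b\<in>B. d a b)"
    using 1 a by (intro cSUP_upper) (auto intro!: bdd_aboveI2)
  finally have "0 \<le> hausdorff_distance d A B" by (simp add: hausdorff_distance_def)
  moreover have "hausdorff_distance d A B \<le> e"
    using 1 2 assms(1,2) by (auto simp: hausdorff_distance_def intro!: cSUP_least)
  ultimately show ?thesis by simp
qed

context Metric_space
begin

text \<open>The uniform bound \<open>C\<close> makes the outer suprema true upper bounds. The
  inequality is strict because the infima need not be attained.\<close>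

lemma hausdorff_distance_approx:
  assumes A: "A \<noteq> {}" "A \<subseteq> M" and B: "B \<noteq> {}" "B \<subseteq> M"
    and bound: "\<And>x y. x \<in> M \<Longrightarrow> y \<in> M \<Longrightarrow> d x y \<le> C" and e: "hausdorff_distance d A B < e"
  shows "a \<in> A \<Longrightarrow> \<exists>b\<in>B. d a b < e" "b \<in> B \<Longrightarrow> \<exists>a\<in>A. d a b < e"
proof -
  have bdd: "bdd_below (f ` D)" if "\<And>x. 0 \<le> f x" for f :: "_ \<Rightarrow> real" and D
    using that by (auto intro: bdd_belowI[of _ 0])
  obtain a0 b0 where ab0: "a0 \<in> A" "b0 \<in> B" using A B by blast
  have "(INF b\<in>B. d a b) \<le> C" if "a \<in> A" for a
    using that A B ab0 bound by (intro cINF_lower2[where x = b0] bdd) auto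
  then have "bdd_above ((\<lambda>a. INF b\<in>B. d a b) ` A)" by (intro bdd_aboveI2)
  moreover have "(INF a\<in>A. d a b) \<le> C" if "b \<in> B" for b
    using that A B ab0 bound by (intro cINF_lower2[where x = a0] bdd) auto
  then have "bdd_above ((\<lambda>b. INF a\<in>A. d a b) ` B)" by (intro bdd_aboveI2)
  ultimately have "(INF b\<in>B. d a b) < e" if "a \<in> A" for a
    using that e cSUP_upper[of a A "\<lambda>a. INF b\<in>B. d a b"] by (simp add: hausdorff_distance_def)
  then show "a \<in> A \<Longrightarrow> \<exists>b\<in>B. d a b < e"
    using B(1) by (subst (asm) cINF_less_iff) (auto intro: bdd)
  have "(INF a\<in>A. d a b) < e" if "b \<in> B" for b
    using \<open>bdd_above ((\<lambda>b. INF a\<in>A. d a b) ` B)\<close> that e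
      cSUP_upper[of b B "\<lambda>b. INF a\<in>A. d a b"] by (simp add: hausdorff_distance_def)
  then show "b \<in> B \<Longrightarrow> \<exists>a\<in>A. d a b < e"
    using A(1) by (subst (asm) cINF_less_iff) (auto intro: bdd)
qed

text \<open>Triangle inequality with a two-sided approximation in place of the distance between
  \<open>A\<close> and \<open>A'\<close>, the form in which two time slices of a flow are
  compared.\<close>

lemma hausdorff_distance_perturb:
  assumes A: "A \<noteq> {}" "A \<subseteq> M" and A': "A' \<noteq> {}" "A' \<subseteq> M" and B: "B \<noteq> {}" "B \<subseteq> M"
    and bound: "\<And>x y. x \<in> M \<Longrightarrow> y \<in> M \<Longrightarrow> d x y \<le> C"
    and AA': "\<And>a. a \<in> A \<Longrightarrow> \<exists>a'\<in>A'. d a a' \<le> e"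
    and A'A: "\<And>a'. a' \<in> A' \<Longrightarrow> \<exists>a\<in>A. d a a' \<le> e"
  shows "hausdorff_distance d A B \<le> e + hausdorff_distance d A' B"
proof (rule field_le_epsilon)
  fix r :: real assume r: "0 < r"
  \<comment> \<open>The slack \<open>r\<close> turns the distance into a strict bound, which yields
    actual nearby points.\<close>
  let ?h = "hausdorff_distance d A' B + r"
  have h: "hausdorff_distance d A' B < ?h" using r by simp
  note approx = hausdorff_distance_approx[OF A' B bound h]
  have "\<bar>hausdorff_distance d A B\<bar> \<le> e + ?h"
  proof (rule hausdorff_distance_abs_le)
    fix a assume a: "a \<in> A"
    then obtain a' where a': "a' \<in> A'" "d a a' \<le> e" using AA' by blast
    then obtain b where b: "b \<in> B" "d a' b < ?h" using approx(1) by blast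
    have "d a b \<le> d a a' + d a' b" using a a'(1) b(1) A A' B by (intro triangle) auto
    then have "d a b \<le> e + ?h" using a' b by simp
    then show "\<exists>b\<in>B. d a b \<le> e + ?h" using b by blast
  next
    fix b assume b: "b \<in> B"
    then obtain a' where a': "a' \<in> A'" "d a' b < ?h" using approx(2) by blast
    then obtain a where a: "a \<in> A" "d a a' \<le> e" using A'A by blast
    have "d a b \<le> d a a' + d a' b" using a(1) a'(1) b A A' B by (intro triangle) auto
    then have "d a b \<le> e + ?h" using a a' by simp
    then show "\<exists>a\<in>A. d a b \<le> e + ?h" using a by blast
  qed (use A B in auto)
  then show "hausdorff_distance d A B \<le> e + hausdorff_distance d A' B + r" by simp
qed

section \<open>Lipschitz flows and orbits of cells\<close>

text \<open>A constant of at least 1 lets the same factor absorb the error at time 0, through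
  \<open>\<delta> \<le> L * \<delta>\<close>.\<close>

lemma lipschitz_flow_constant:
  assumes "lipschitz_flow d M S" "0 < T"
  obtains L where "1 \<le> L"
    "\<And>s t x y. \<bar>s\<bar> \<le> T \<Longrightarrow> \<bar>t\<bar> \<le> T \<Longrightarrow> x \<in> M \<Longrightarrow> y \<in> M \<Longrightarrow>
      d (S s x) (S t y) \<le> L * (\<bar>s - t\<bar> + d x y)"
proof -
  obtain L where L: "\<forall>s\<in>{-T..T}. \<forall>t\<in>{-T..T}. \<forall>x\<in>M. \<forall>y\<in>M.
      d (S s x) (S t y) \<le> L * (\<bar>s - t\<bar> + d x y)"
    using assms unfolding lipschitz_flow_def by blast
  show thesis
  proof (rule that[of "max 1 L"])
    fix s t x y assume "\<bar>s\<bar> \<le> T" "\<bar>t\<bar> \<le> T" "x \<in> M" "y \<in> M"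
    then have "d (S s x) (S t y) \<le> L * (\<bar>s - t\<bar> + d x y)"
      using L by (simp add: abs_le_iff)
    also have "\<dots> \<le> max 1 L * (\<bar>s - t\<bar> + d x y)" by (intro mult_right_mono) auto
    finally show "d (S s x) (S t y) \<le> max 1 L * (\<bar>s - t\<bar> + d x y)" .
  qed simp
qed

text \<open>Passing from time \<open>s\<close> to \<open>t\<close> displaces each point of the
  moving set by at most \<open>L * \<bar>s - t\<bar>\<close>, so the distance to the fixed
  \<open>B\<close> is locally Lipschitz in time. This serves the measurability of the
  integrand.\<close>

lemma continuous_hausdorff_distance_flow:
  assumes S: "lipschitz_flow d M S" and A: "A \<noteq> {}" "A \<subseteq> M" and B: "B \<noteq> {}" "B \<subseteq> M"
    and bound: "\<And>x y. x \<in> M \<Longrightarrow> y \<in> M \<Longrightarrow> d x y \<le> C"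
  shows "continuous_on UNIV (\<lambda>s. hausdorff_distance d (S s ` A) B)"
proof (rule continuous_at_imp_continuous_on, rule ballI)
  fix r :: real
  \<comment> \<open>The extra 1 puts \<open>r\<close> inside the open interval on which one constant
    is valid.\<close>
  define T where "T = \<bar>r\<bar> + 1"
  have T: "0 < T" by (simp add: T_def)
  obtain L where L: "1 \<le> L"
    "\<And>s t x y. \<bar>s\<bar> \<le> T \<Longrightarrow> \<bar>t\<bar> \<le> T \<Longrightarrow> x \<in> M \<Longrightarrow> y \<in> M \<Longrightarrow>
      d (S s x) (S t y) \<le> L * (\<bar>s - t\<bar> + d x y)"
    using lipschitz_flow_constant[OF S T] by blast
  have SM: "S s ` A \<subseteq> M" for s using S A by (auto simp: lipschitz_flow_def flow_on_def)
  let ?f = "\<lambda>s. hausdorff_distance d (S s ` A) B"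
  have close: "d (S s x) (S t x) \<le> L * \<bar>s - t\<bar>" if "\<bar>s\<bar> \<le> T" "\<bar>t\<bar> \<le> T" "x \<in> A" for s t x
    using L(2)[of s t x x] that A by auto
  have le: "?f s \<le> L * \<bar>s - t\<bar> + ?f t" if "\<bar>s\<bar> \<le> T" "\<bar>t\<bar> \<le> T" for s t
  proof (rule hausdorff_distance_perturb[OF _ SM _ SM B bound])
    show "\<exists>a'\<in>S t ` A. d a a' \<le> L * \<bar>s - t\<bar>" if "a \<in> S s ` A" for a
      using that close[OF \<open>\<bar>s\<bar> \<le> T\<close> \<open>\<bar>t\<bar> \<le> T\<close>] by auto
    show "\<exists>a\<in>S s ` A. d a a' \<le> L * \<bar>s - t\<bar>" if "a' \<in> S t ` A" for a'
      using that close[OF \<open>\<bar>s\<bar> \<le> T\<close> \<open>\<bar>t\<bar> \<le> T\<close>] by auto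
  qed (use A in auto)
  have "L-lipschitz_on {-T<..<T} ?f"
  proof (rule lipschitz_onI)
    fix s t assume "s \<in> {-T<..<T}" "t \<in> {-T<..<T}"
    then have "?f s \<le> L * \<bar>s - t\<bar> + ?f t" "?f t \<le> L * \<bar>s - t\<bar> + ?f s"
      using le[of s t] le[of t s] by (auto simp: abs_minus_commute)
    then show "dist (?f s) (?f t) \<le> L * dist s t" by (auto simp: dist_real_def)
  qed (use L in simp)
  then have "continuous_on {-T<..<T} ?f" by (rule lipschitz_on_continuous_on)
  then show "isCont ?f r"
    by (rule continuous_on_interior) (auto simp: T_def)
qed

text \<open>
  The error is telescoped through the maps \<open>S (j h)\<close> with \<open>j \<le> k\<close>, which share the constant \<open>L\<close>;
  composing \<open>k\<close> single steps would produce the useless factor \<open>L ^ k\<close>.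
\<close>

lemma funpow_cell_tracks_flow:
  assumes S: "flow_on M S" and "1 \<le> L"
    and lip: "\<And>r x y. \<bar>r\<bar> \<le> T \<Longrightarrow> x \<in> M \<Longrightarrow> y \<in> M \<Longrightarrow> d (S r x) (S r y) \<le> L * d x y"
    and P: "\<And>p. p \<in> P \<Longrightarrow> p \<subseteq> M"
    and diam: "\<And>p x y. p \<in> P \<Longrightarrow> x \<in> p \<Longrightarrow> y \<in> p \<Longrightarrow> d x y \<le> \<delta>"
    and \<sigma>: "\<And>p. p \<in> P \<Longrightarrow> \<sigma> p \<in> P \<and> (\<exists>x\<in>p. S h x \<in> \<sigma> p)"
    and "p \<in> P" "x \<in> p" "y \<in> (\<sigma> ^^ k) p" "real k * \<bar>h\<bar> \<le> T"
  shows "d (S (real k * h) x) y \<le> (real k + 1) * (L * \<delta>)"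
  using assms(7-)
proof (induction k arbitrary: p x)
  case 0
  then have "d x y \<le> \<delta>" using diam by simp
  \<comment> \<open>Nonnegativity of \<open>\<delta>\<close> is read off from \<open>d x y\<close>,
    as \<open>x\<close> and \<open>y\<close> share a cell when no step is taken.\<close>
  moreover have "\<delta> \<le> L * \<delta>"
    using \<open>d x y \<le> \<delta>\<close> \<open>1 \<le> L\<close> nonneg[of x y] mult_right_mono[of 1 L \<delta>] by linarith
  moreover have "x \<in> M" using 0 P by blast
  ultimately show ?case using S by (auto simp: flow_on_def)
next
  case (Suc k)
  \<comment> \<open>The witness \<open>z\<close> shares the cell \<open>p\<close> with
    \<open>x\<close> and enters \<open>\<sigma> p\<close> in one step, so the induction hypothesis
    applies to \<open>S h z\<close>. Exchanging \<open>x\<close> for \<open>z\<close> under the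
    whole map \<open>S (real (Suc k) * h)\<close> adds \<open>L * \<delta>\<close> once.\<close>
  obtain z where z: "z \<in> p" "S h z \<in> \<sigma> p" using \<sigma> Suc.prems by blast
  have \<sigma>p: "\<sigma> p \<in> P" using \<sigma> Suc.prems by blast
  have M: "x \<in> M" "z \<in> M" "y \<in> M"
  proof -
    have "(\<sigma> ^^ j) p \<in> P" for j using \<sigma> Suc.prems(1) by (induction j) auto
    then show "y \<in> M" using P Suc.prems(3) by blast
  qed (use Suc.prems P z in auto)
  have eq: "S (real (Suc k) * h) z = S (real k * h) (S h z)"
    using S M by (simp add: flow_on_def algebra_simps)
  have "real k * \<bar>h\<bar> \<le> real (Suc k) * \<bar>h\<bar>" by (simp add: mult_right_mono)
  then have "d (S (real k * h) (S h z)) y \<le> (real k + 1) * (L * \<delta>)"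
    using Suc.prems z \<sigma>p by (intro Suc.IH[of "\<sigma> p"]) (auto simp: funpow_swap1)
  moreover have "d (S (real (Suc k) * h) x) (S (real (Suc k) * h) z) \<le> L * d x z"
    using Suc.prems(4) M by (intro lip) (auto simp: abs_mult)
  moreover have "L * d x z \<le> L * \<delta>"
    using diam[of p x z] Suc.prems z \<open>1 \<le> L\<close> by (intro mult_left_mono) auto
  moreover have "d (S (real (Suc k) * h) x) y
      \<le> d (S (real (Suc k) * h) x) (S (real (Suc k) * h) z) + d (S (real (Suc k) * h) z) y"
    using M S by (intro triangle) (auto simp: flow_on_def)
  ultimately show ?case unfolding eq by (simp add: algebra_simps)
qed

lemma iterate_cell_tracks_flow:
  assumes S: "flow_on M S" and "1 \<le> L"
    and lip: "\<And>r x y. \<bar>r\<bar> \<le> T \<Longrightarrow> x \<in> M \<Longrightarrow> y \<in> M \<Longrightarrow> d (S r x) (S r y) \<le> L * d x y"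
    and P: "\<And>p. p \<in> P \<Longrightarrow> p \<subseteq> M"
    and diam: "\<And>p x y. p \<in> P \<Longrightarrow> x \<in> p \<Longrightarrow> y \<in> p \<Longrightarrow> d x y \<le> \<delta>"
    and \<sigma>: "bij_betw \<sigma> P P" "\<And>p. p \<in> P \<Longrightarrow> \<exists>x\<in>p. S h x \<in> \<sigma> p"
    and p: "p \<in> P" "x \<in> p" "y \<in> iterate P \<sigma> k p" and k: "\<bar>real_of_int k\<bar> * \<bar>h\<bar> \<le> T"
  shows "d (S (real_of_int k * h) x) y \<le> (\<bar>real_of_int k\<bar> + 1) * (L * \<delta>)"
proof (cases "0 \<le> k")
  case True
  have "d (S (real (nat k) * h) x) y \<le> (real (nat k) + 1) * (L * \<delta>)"
    by (rule funpow_cell_tracks_flow[OF S \<open>1 \<le> L\<close> lip P diam])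
      (use True \<sigma> p k in \<open>auto simp: iterate_def bij_betw_apply\<close>)
  then show ?thesis using True by simp
next
  case False
  \<comment> \<open>Backward iterates are forward iterates of the inverse permutation with time step
    \<open>- h\<close>: if \<open>z\<close> lies in \<open>?\<rho> p\<close> and
    \<open>S h z\<close> in \<open>p\<close>, then \<open>S h z\<close> is a point of
    \<open>p\<close> that \<open>S (- h)\<close> returns to \<open>?\<rho> p\<close>.\<close>
  let ?\<rho> = "inv_into P \<sigma>"
  have "d (S (real (nat (- k)) * - h) x) y \<le> (real (nat (- k)) + 1) * (L * \<delta>)"
  proof (rule funpow_cell_tracks_flow[OF S \<open>1 \<le> L\<close> lip P diam])
    fix p assume p: "p \<in> P"
    then have \<rho>: "?\<rho> p \<in> P" "\<sigma> (?\<rho> p) = p"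
      using \<sigma>(1) by (auto simp: bij_betw_def inv_into_into f_inv_into_f)
    then obtain z where z: "z \<in> ?\<rho> p" "S h z \<in> p" using \<sigma>(2)[of "?\<rho> p"] by auto
    then have "z \<in> M" using P \<rho> by blast
    then have "S (- h) (S h z) = z" using S by (simp add: flow_on_def)
    then show "?\<rho> p \<in> P \<and> (\<exists>x\<in>p. S (- h) x \<in> ?\<rho> p)" using z \<rho> by force
  qed (use False p k in \<open>auto simp: iterate_def\<close>)
  then show ?thesis using False by simp
qed

end

section \<open>Integer iterates and rounded times\<close>

lemma iterate_in:
  assumes "bij_betw \<sigma> P P" "p \<in> P"
  shows "iterate P \<sigma> k p \<in> P"
proof -
  have "(f ^^ j) p \<in> P" if "bij_betw f P P" for f j
    using that assms(2) by (induction j) (auto simp: bij_betw_apply)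
  then show ?thesis
    using assms(1) bij_betw_inv_into[OF assms(1)] by (simp add: iterate_def)
qed

text \<open>Rounding away from 0 overshoots by at most one step \<open>h\<close>. The first bound
  keeps rounded times in the range of one Lipschitz constant; the second is the time error.\<close>

lemma xi_steps_bounds:
  assumes "0 < h"
  shows "\<bar>real_of_int (xi_steps h s)\<bar> * h \<le> \<bar>s\<bar> + h" "\<bar>s - real_of_int (xi_steps h s) * h\<bar> \<le> h"
proof -
  define c where "c = \<lceil>\<bar>s\<bar> / h\<rceil>"
  have c: "\<bar>s\<bar> / h \<le> c" "c < \<bar>s\<bar> / h + 1" "0 \<le> c"
    using assms ceiling_correct[of "\<bar>s\<bar> / h"] by (auto simp: c_def intro: order_less_le_trans[of _ 0])
  then have "\<bar>s\<bar> \<le> c * h" "c * h \<le> \<bar>s\<bar> + h"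
    using assms by (auto simp: field_simps)
  moreover have xi: "xi_steps h s = (if s < 0 then - c else c)"
    by (simp add: xi_steps_def c_def)
  ultimately show "\<bar>real_of_int (xi_steps h s)\<bar> * h \<le> \<bar>s\<bar> + h"
    "\<bar>s - real_of_int (xi_steps h s) * h\<bar> \<le> h"
    using c(3) xi by auto
qed

text \<open>The discrete target lets the integrand be split over the countably many step
  counts.\<close>

lemma measurable_xi_steps: "xi_steps h \<in> measurable borel (count_space UNIV)"
  unfolding xi_steps_def by measurable

section \<open>Arbitrary norms on Euclidean space\<close>

text \<open>Expanding a vector in the standard basis gives as constant the sum of the norms of the
  basis vectors. This transfers boundedness of \<open>X\<close> to the given metric.\<close>

lemma is_norm_le_norm:
  fixes \<nu> :: "'a::euclidean_space \<Rightarrow> real"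
  assumes "is_norm \<nu>"
  obtains C where "0 \<le> C" "\<And>x. \<nu> x \<le> C * norm x"
proof
  have add: "\<nu> (x + y) \<le> \<nu> x + \<nu> y" and scale: "\<nu> (c *\<^sub>R x) = \<bar>c\<bar> * \<nu> x"
    and nonneg: "0 \<le> \<nu> x" and zero: "\<nu> 0 = 0" for x y c
    using assms by (auto simp: is_norm_def)
  show "0 \<le> (\<Sum>b\<in>Basis. \<nu> b)" by (simp add: sum_nonneg nonneg)
  fix x
  have sum: "\<nu> (\<Sum>b\<in>F. g b) \<le> (\<Sum>b\<in>F. \<nu> (g b))" if "finite F" for g :: "'a \<Rightarrow> 'a" and F
    using that by induction (auto simp: zero intro: order_trans[OF add])
  have "\<nu> x = \<nu> (\<Sum>b\<in>Basis. (x \<bullet> b) *\<^sub>R b)" by (simp add: euclidean_representation)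
  also have "\<dots> \<le> (\<Sum>b\<in>Basis. \<nu> ((x \<bullet> b) *\<^sub>R b))" by (rule sum) simp
  also have "\<dots> \<le> (\<Sum>b\<in>Basis. norm x * \<nu> b)"
    unfolding scale by (intro sum_mono mult_right_mono nonneg Basis_le_norm)
  finally show "\<nu> x \<le> (\<Sum>b\<in>Basis. \<nu> b) * norm x"
    by (simp add: sum_distrib_left mult.commute)
qed

lemma Metric_space_norm_dist:
  assumes "is_norm \<nu>"
  shows "Metric_space X (norm_dist \<nu>)"
proof
  have "\<nu> (- x) = \<nu> x" for x
    using assms unfolding is_norm_def by (metis abs_minus_cancel abs_one mult_1 scaleR_minus1_left)
  then show "norm_dist \<nu> x y = norm_dist \<nu> y x" for x y
    unfolding norm_dist_def by (metis minus_diff_eq)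
  show "norm_dist \<nu> x z \<le> norm_dist \<nu> x y + norm_dist \<nu> y z" for x y z
  proof -
    have "x - z = (x - y) + (y - z)" by simp
    then show ?thesis using assms unfolding is_norm_def norm_dist_def by metis
  qed
qed (use assms in \<open>auto simp: is_norm_def norm_dist_def\<close>)

lemma norm_dist_bounded:
  fixes X :: "'a::euclidean_space set"
  assumes "is_norm \<nu>" "bounded X"
  obtains C where "\<And>x y. x \<in> X \<Longrightarrow> y \<in> X \<Longrightarrow> norm_dist \<nu> x y \<le> C"
proof -
  obtain K where K: "0 \<le> K" "\<And>x. \<nu> x \<le> K * norm x" using is_norm_le_norm[OF assms(1)] by blast
  have "norm_dist \<nu> x y \<le> K * diameter X" if "x \<in> X" "y \<in> X" for x y
  proof -
    have "norm (x - y) \<le> diameter X"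
      using diameter_bounded_bound[OF assms(2) that] by (simp add: dist_norm)
    then have "K * norm (x - y) \<le> K * diameter X" using K(1) by (rule mult_left_mono)
    then show ?thesis using K(2)[of "x - y"] by (simp add: norm_dist_def)
  qed
  then show thesis using that by blast
qed

text \<open>The bound \<open>C\<close> makes the real-valued supremum one over a bounded set, so
  that it dominates each distance.\<close>

lemma le_set_diam:
  assumes "\<And>x y. x \<in> A \<Longrightarrow> y \<in> A \<Longrightarrow> d x y \<le> C" "x \<in> A" "y \<in> A"
  shows "d x y \<le> set_diam d A"
proof -
  have "bdd_above ((\<lambda>(x, y). d x y) ` (A \<times> A))"
    using assms(1) by (auto intro!: bdd_aboveI[of _ C])
  then have "(\<lambda>(x, y). d x y) (x, y) \<le> set_diam d A"
    unfolding set_diam_def using assms(2,3) by (intro cSUP_upper) auto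
  then show ?thesis by simp
qed

section \<open>Integrals over oriented intervals\<close>

lemma interval_lebesgue_integrable_bounded:
  fixes f :: "real \<Rightarrow> real"
  assumes [measurable]: "f \<in> borel_measurable borel" and "\<And>s. \<bar>f s\<bar> \<le> C"
  shows "interval_lebesgue_integrable lborel (ereal a) (ereal b) f"
proof -
  \<comment> \<open>Both orders of the endpoints occur: integrability sorts them, and
    \<open>t\<close> in the theorem may be negative.\<close>
  have "set_integrable lborel (einterval (ereal u) (ereal v)) f" for u v
    unfolding set_integrable_def
    by (rule integrableI_bounded_set[where A = "{u..v}" and B = C])
      (use assms(2) order_trans[OF abs_ge_zero assms(2)] in
        \<open>auto simp: einterval_def indicator_def emeasure_lborel_Icc_eq\<close>)
  then show ?thesis by (simp add: interval_lebesgue_integrable_def)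
qed

text \<open>Reversing the endpoints only flips the sign of the integral, so the case
  \<open>a \<le> b\<close> decides.\<close>

lemma interval_integral_abs_le:
  fixes f :: "real \<Rightarrow> real"
  assumes "interval_lebesgue_integrable lborel (ereal a) (ereal b) f"
    and "\<And>s. s \<in> {min a b..max a b} \<Longrightarrow> \<bar>f s\<bar> \<le> e"
  shows "\<bar>LBINT s=ereal a..ereal b. f s\<bar> \<le> e * \<bar>b - a\<bar>"
  using assms
proof (induction a b rule: linorder_wlog)
  case (le a b)
  have "\<bar>LBINT s=ereal a..ereal b. f s\<bar> \<le> (LBINT s=ereal a..ereal b. \<bar>f s\<bar>)"
    using interval_integral_norm[OF le(2)] le(1) by simp
  also have "\<dots> = (LBINT s:{a<..<b}. \<bar>f s\<bar>)"
    using le(1) by (simp add: interval_lebesgue_integral_le_eq)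
  also have "\<dots> \<le> (LBINT s:{a<..<b}. e)"
  proof (rule set_integral_mono)
    show "set_integrable lborel {a<..<b} (\<lambda>s. \<bar>f s\<bar>)"
      using le(1,2) by (simp add: interval_lebesgue_integrable_def set_integrable_abs)
  qed (use le in \<open>auto simp: set_integrable_def\<close>)
  also have "\<dots> = e * \<bar>b - a\<bar>" using le(1) by (simp add: set_lebesgue_integral_def)
  finally show ?case .
next
  case (sym a b)
  then show ?case
    by (subst interval_integral_endpoints_reverse)
      (auto simp: interval_integrable_endpoints_reverse[of "ereal b"] abs_minus_commute
        min.commute max.commute)
qed

section \<open>Convergence of the periodic approximations in the integrated Hausdorff
  distance\<close>

theorem theorem3p2:
  fixes \<nu> :: "real ^ 'n \<Rightarrow> real"
    and X :: "(real ^ 'n) set"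
    and S :: "real \<Rightarrow> real ^ 'n \<Rightarrow> real ^ 'n"
    and \<mu> :: "(real ^ 'n) measure"
    and \<tau> l :: "nat \<Rightarrow> real"
    and q :: "nat \<Rightarrow> nat"
    and P :: "nat \<Rightarrow> (real ^ 'n) set set"
  assumes "is_norm \<nu>"
    and "compact X"
    and "lipschitz_flow (norm_dist \<nu>) X S"
    and "reference_measure X \<mu>"
    and "preserves_measure S \<mu>"
    and "time_steps \<tau>"
    and "partition_sequence (norm_dist \<nu>) X \<mu> q l P"
    and "(\<lambda>n. l n / \<tau> n) \<longlonglongrightarrow> 0"
  shows "\<exists>\<sigma>. (\<forall>n\<ge>1. periodic_approximation (P n) (\<sigma> n)) \<and>
    (\<forall>(t::real) A. A \<noteq> {} \<longrightarrow> compact A \<longrightarrow> A \<subseteq> X \<longrightarrow>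
       (\<forall>n\<ge>1. interval_lebesgue_integrable lborel (ereal (- t)) (ereal t)
          (\<lambda>s. hausdorff_distance (norm_dist \<nu>) (S s ` A)
             (iterate_union (P n) (\<sigma> n) (xi_steps (\<tau> n) s) (cells_meeting (P n) A)))) \<and>
       (\<lambda>n. LBINT s=ereal (- t)..ereal t. hausdorff_distance (norm_dist \<nu>) (S s ` A)
          (iterate_union (P n) (\<sigma> n) (xi_steps (\<tau> n) s) (cells_meeting (P n) A)))
         \<longlonglongrightarrow> 0)"
proof -
  let ?d = "norm_dist \<nu>"
  interpret Metric_space X ?d using assms(1) by (rule Metric_space_norm_dist)
  have S: "flow_on X S" and lipschitz: "lipschitz_flow ?d X S"
    using assms(3) by (auto simp: lipschitz_flow_def)
  have \<mu>: "space \<mu> = X" "sets \<mu> = sets (restrict_space borel X)" "emeasure \<mu> X \<noteq> 0"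
    and fin: "finite_measure \<mu>"
    using assms(4) by (auto simp: reference_measure_def)
  interpret finite_measure \<mu> by (rule fin)
  have mass_X: "0 < measure \<mu> X" using \<mu>(3) by (simp add: emeasure_eq_measure zero_less_measure_iff)
  obtain C where C: "\<And>x y. x \<in> X \<Longrightarrow> y \<in> X \<Longrightarrow> ?d x y \<le> C"
    using norm_dist_bounded[OF assms(1)] compact_imp_bounded[OF assms(2)] by metis
  have \<tau>_pos: "0 < \<tau> n" if "1 \<le> n" for n using assms(6) that by (simp add: time_steps_def)
  have \<tau>_le: "\<tau> n \<le> \<tau> 1" if "1 \<le> n" for n
    using assms(6) that by (auto simp: time_steps_def monotone_on_def)
  have \<tau>_lim: "\<tau> \<longlonglongrightarrow> 0" using assms(6) by (simp add: time_steps_def)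
  have l_lim: "l \<longlonglongrightarrow> 0" using assms(7) by (simp add: partition_sequence_def)
  have P: "finite (P n)" "card (P n) = q n" "\<Union>(P n) = X"
    "\<And>p p'. p \<in> P n \<Longrightarrow> p' \<in> P n \<Longrightarrow> p \<noteq> p' \<Longrightarrow> p \<inter> p' \<in> null_sets \<mu>"
    "\<And>p. p \<in> P n \<Longrightarrow> compact p"
    "\<And>p. p \<in> P n \<Longrightarrow> measure \<mu> p = measure \<mu> X / real (q n)"
    "\<And>p. p \<in> P n \<Longrightarrow> set_diam ?d p \<le> l n" if "1 \<le> n" for n
    using assms(7) that by (simp_all add: partition_sequence_def)
  have cell_subset: "p \<subseteq> X" if "1 \<le> n" "p \<in> P n" for n p using P(3) that by blast
  \<comment> \<open>Positive mass of \<open>X\<close> forces cells to exist, and equal positive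
    shares force each of them to be nonempty.\<close>
  have q_pos: "0 < q n" if "1 \<le> n" for n
    using P(1-3)[OF that] mass_X by (cases "P n = {}") (auto simp: card_gt_0_iff)
  have cell_nonempty: "p \<noteq> {}" if "1 \<le> n" "p \<in> P n" for n p
    using P(6)[OF that] mass_X q_pos[OF that(1)] by auto
  have diam: "?d x y \<le> l n" if "1 \<le> n" "p \<in> P n" "x \<in> p" "y \<in> p" for n p x y
  proof -
    have "?d x y \<le> set_diam ?d p"
      using that cell_subset[OF that(1,2)] by (intro le_set_diam[where C = C] C) auto
    then show ?thesis using P(7)[OF that(1,2)] by simp
  qed
  have "\<exists>\<sigma>. bij_betw \<sigma> (P n) (P n) \<and> (\<forall>p\<in>P n. \<exists>x\<in>p. S (\<tau> n) x \<in> \<sigma> p)" if n: "1 \<le> n" for n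
  proof (rule ex_permutation_of_equal_cells[where c = "measure \<mu> X / real (q n)"])
    show "P n \<subseteq> sets \<mu>"
    proof
      fix p assume p: "p \<in> P n"
      then have "p \<inter> X \<in> sets (restrict_space borel X)"
        using P(5)[OF n] by (auto simp: sets_restrict_space intro!: imageI borel_compact)
      then show "p \<in> sets \<mu>" using cell_subset[OF n p] \<mu>(2) by (simp add: Int_absorb2)
    qed
    show "finite (P n)" "\<Union>(P n) = space \<mu>" using P[OF n] \<mu>(1) by auto
    show "p \<inter> p' \<in> null_sets \<mu>" if "p \<in> P n" "p' \<in> P n" "p \<noteq> p'" for p p'
      using P(4)[OF n] that by blast
    show "measure \<mu> p = measure \<mu> X / real (q n)" if "p \<in> P n" for p
      using P(6)[OF n] that by blast
    show "0 < measure \<mu> X / real (q n)" using mass_X q_pos[OF n] by simp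
    show "S (\<tau> n) \<in> space \<mu> \<rightarrow> space \<mu>" using S \<mu>(1) by (simp add: flow_on_def)
    show "emeasure \<mu> (S (\<tau> n) ` B) = emeasure \<mu> B" if "B \<in> sets \<mu>" for B
      using assms(5) that by (simp add: preserves_measure_def)
  qed
  then obtain \<sigma> where \<sigma>: "\<And>n. 1 \<le> n \<Longrightarrow> bij_betw (\<sigma> n) (P n) (P n)"
    "\<And>n p. 1 \<le> n \<Longrightarrow> p \<in> P n \<Longrightarrow> \<exists>x\<in>p. S (\<tau> n) x \<in> \<sigma> n p"
    by metis
  \<comment> \<open>The step count \<open>k\<close> stays a parameter, so that it can be frozen in
    the measurability proof.\<close>
  define U where "U A n k = iterate_union (P n) (\<sigma> n) k (cells_meeting (P n) A)" for A n k
  let ?D = "\<lambda>A n s. hausdorff_distance ?d (S s ` A) (U A n (xi_steps (\<tau> n) s))"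
  have U: "U A n k \<noteq> {}" "U A n k \<subseteq> X" if A: "A \<noteq> {}" "A \<subseteq> X" and n: "1 \<le> n" for A n k
  proof -
    have it: "iterate (P n) (\<sigma> n) k p \<in> P n" if "p \<in> P n" for p
      by (rule iterate_in[OF \<sigma>(1)[OF n] that])
    have eq: "U A n k = (\<Union>p\<in>cells_meeting (P n) A. iterate (P n) (\<sigma> n) k p)"
      by (simp add: U_def iterate_union_def)
    have cells: "cells_meeting (P n) A \<subseteq> P n" by (auto simp: cells_meeting_def)
    obtain x where x: "x \<in> A" using A(1) by blast
    then have "x \<in> \<Union>(P n)" unfolding P(3)[OF n] by (rule subsetD[OF A(2)])
    then obtain p where "p \<in> P n" "x \<in> p" by (rule UnionE)
    then have p: "p \<in> cells_meeting (P n) A" using x by (auto simp: cells_meeting_def)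
    then have "iterate (P n) (\<sigma> n) k p \<noteq> {}" 
      by (intro cell_nonempty[OF n] it subsetD[OF cells])
    then show "U A n k \<noteq> {}" unfolding eq using p by auto
    show "U A n k \<subseteq> X"
      unfolding eq by (intro UN_least cell_subset[OF n] it subsetD[OF cells])
  qed
  have image: "S s ` A \<noteq> {}" "S s ` A \<subseteq> X" if "A \<noteq> {}" "A \<subseteq> X" for s A
    using that S by (auto simp: flow_on_def)
  have integrable: "interval_lebesgue_integrable lborel (ereal a) (ereal b) (?D A n)"
    if A: "A \<noteq> {}" "A \<subseteq> X" and n: "1 \<le> n" for a b A n
  proof (rule interval_lebesgue_integrable_bounded)
    \<comment> \<open>For a frozen step count the distance is continuous in time; as the step count
      is a measurable function with countably many values, the integrand is Borel.\<close>
    have "(\<lambda>s. hausdorff_distance ?d (S s ` A) (U A n k)) \<in> borel_measurable borel" for k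
      by (intro borel_measurable_continuous_onI
          continuous_hausdorff_distance_flow[OF lipschitz A U[OF A n] C])
    then show "?D A n \<in> borel_measurable borel"
      by (rule measurable_compose_countable
          [where f = "\<lambda>k s. hausdorff_distance ?d (S s ` A) (U A n k)", OF _ measurable_xi_steps])
    fix s
    let ?B = "U A n (xi_steps (\<tau> n) s)"
    have B: "?B \<noteq> {}" "?B \<subseteq> X" by (rule U[OF A n])+
    have SA: "S s ` A \<noteq> {}" "S s ` A \<subseteq> X" by (rule image[OF A])+
    obtain a0 b0 where "a0 \<in> S s ` A" "b0 \<in> ?B" using SA(1) B(1) by (metis ex_in_conv)
    have le: "?d a b \<le> C" if "a \<in> S s ` A" "b \<in> ?B" for a b
      by (rule C[OF subsetD[OF SA(2) that(1)] subsetD[OF B(2) that(2)]])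
    have "\<exists>b\<in>?B. ?d a b \<le> C" if "a \<in> S s ` A" for a
      using le[OF that \<open>b0 \<in> ?B\<close>] \<open>b0 \<in> ?B\<close> by (rule bexI)
    moreover have "\<exists>a\<in>S s ` A. ?d a b \<le> C" if "b \<in> ?B" for b
      using le[OF \<open>a0 \<in> S s ` A\<close> that] \<open>a0 \<in> S s ` A\<close> by (rule bexI)
    ultimately show "\<bar>?D A n s\<bar> \<le> C"
      by (rule hausdorff_distance_abs_le[OF SA(1) B(1) nonneg])
  qed
  have lim: "(\<lambda>n. LBINT s=ereal (- t)..ereal t. ?D A n s) \<longlonglongrightarrow> 0"
    if A: "A \<noteq> {}" "A \<subseteq> X" for t A
  proof -
    \<comment> \<open>Rounded times overshoot by at most \<open>\<tau> n\<close>, hence by at most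
      \<open>\<tau> 1\<close>; one \<open>L\<close> on this range serves all
      \<open>n \<ge> 1\<close>.\<close>
    define T where "T = \<bar>t\<bar> + \<tau> 1"
    have T: "0 < T" using \<tau>_pos[of 1] by (simp add: T_def)
    obtain L where L: "1 \<le> L"
      "\<And>s t x y. \<bar>s\<bar> \<le> T \<Longrightarrow> \<bar>t\<bar> \<le> T \<Longrightarrow> x \<in> X \<Longrightarrow> y \<in> X \<Longrightarrow>
        ?d (S s x) (S t y) \<le> L * (\<bar>s - t\<bar> + ?d x y)"
      using lipschitz_flow_constant[OF lipschitz T] by blast
    \<comment> \<open>The first summand is the time rounding error, the second the tracking error
      over at most \<open>T / \<tau> n\<close> steps. The limit of \<open>l n / \<tau> n\<close>
      makes the latter vanish.\<close>
    define e where "e n = L * \<tau> n + (T / \<tau> n + 1) * (L * l n)" for n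
    have e_lim: "e \<longlonglongrightarrow> 0"
    proof -
      have "(\<lambda>n. L * \<tau> n + (T * L * (l n / \<tau> n) + L * l n)) \<longlonglongrightarrow> L * 0 + (T * L * 0 + L * 0)"
        by (intro tendsto_intros \<tau>_lim l_lim assms(8))
      moreover have "L * \<tau> n + (T * L * (l n / \<tau> n) + L * l n) = e n" for n
        by (simp add: e_def algebra_simps)
      ultimately show ?thesis by simp
    qed
    have close: "\<bar>?D A n s\<bar> \<le> e n" if n: "1 \<le> n" and s: "\<bar>s\<bar> \<le> \<bar>t\<bar>" for n s
    proof -
      let ?h = "\<tau> n"
      define k where "k = xi_steps ?h s"
      have k: "\<bar>real_of_int k\<bar> * ?h \<le> T" "\<bar>s - real_of_int k * ?h\<bar> \<le> ?h"
        using xi_steps_bounds[OF \<tau>_pos[OF n], of s] \<tau>_le[OF n] s by (auto simp: k_def T_def)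
      have sT: "\<bar>s\<bar> \<le> T" using s \<tau>_pos[of 1] by (simp add: T_def)
      have kT: "\<bar>real_of_int k * ?h\<bar> \<le> T" using k(1) \<tau>_pos[OF n] by (simp add: abs_mult)
      have track: "?d (S s x) y \<le> e n"
        if p: "p \<in> P n" "x \<in> p" "y \<in> iterate (P n) (\<sigma> n) k p" for p x y
      proof -
        have x: "x \<in> X" using cell_subset[OF n p(1)] p(2) by blast
        have y: "y \<in> X" using cell_subset[OF n iterate_in[OF \<sigma>(1)[OF n] p(1)]] p(3) by blast
        have "?d (S s x) (S (real_of_int k * ?h) x) \<le> L * ?h"
        proof -
          have "?d (S s x) (S (real_of_int k * ?h) x) \<le> L * \<bar>s - real_of_int k * ?h\<bar>"
            using L(2)[OF sT kT x x] x by simp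
          also have "\<dots> \<le> L * ?h" using k(2) L(1) by (intro mult_left_mono) auto
          finally show ?thesis .
        qed
        moreover have "?d (S (real_of_int k * ?h) x) y \<le> (T / ?h + 1) * (L * l n)"
        proof -
          have "0 \<le> l n" using diam[OF n p(1) p(2) p(2)] nonneg[of x x] by linarith
          have "?d (S (real_of_int k * ?h) x) y \<le> (\<bar>real_of_int k\<bar> + 1) * (L * l n)"
          proof (rule iterate_cell_tracks_flow[OF S L(1)])
            show "?d (S r x) (S r y) \<le> L * ?d x y" if "\<bar>r\<bar> \<le> T" "x \<in> X" "y \<in> X" for r x y
              using L(2)[of r r x y] that by simp
          qed (use cell_subset[OF n] diam[OF n] \<sigma>[OF n] p k(1) \<tau>_pos[OF n] in auto)
          also have "\<dots> \<le> (T / ?h + 1) * (L * l n)"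
            using k(1) L(1) \<open>0 \<le> l n\<close> \<tau>_pos[OF n]
            by (intro mult_right_mono) (auto simp: field_simps)
          finally show ?thesis .
        qed
        moreover have "?d (S s x) y \<le> ?d (S s x) (S (real_of_int k * ?h) x)
            + ?d (S (real_of_int k * ?h) x) y"
          using S x y by (intro triangle) (auto simp: flow_on_def)
        ultimately show ?thesis by (simp add: e_def)
      qed
      \<comment> \<open>A point of \<open>A\<close> lies in some cell, which therefore meets
        \<open>A\<close>; any point of the iterate of this cell will do.\<close>
      have AB: "\<exists>b\<in>U A n k. ?d a b \<le> e n" if a: "a \<in> S s ` A" for a
      proof -
        obtain x where x: "x \<in> A" "a = S s x" using a by blast
        then obtain p where p: "p \<in> P n" "x \<in> p" 
          using A(2) P(3)[OF n] by (metis UnionE subsetD)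
        obtain y where "y \<in> iterate (P n) (\<sigma> n) k p"
          using cell_nonempty[OF n iterate_in[OF \<sigma>(1)[OF n] p(1)]] by (auto simp: ex_in_conv[symmetric])
        then show ?thesis
          using track[of p x y] x p by (auto simp: U_def iterate_union_def cells_meeting_def)
      qed
      \<comment> \<open>Conversely, each iterated cell comes from a cell containing some
        \<open>x\<close> in \<open>A\<close>, and \<open>track\<close> compares all its points with
        \<open>S s x\<close>.\<close>
      have BA: "\<exists>a\<in>S s ` A. ?d a b \<le> e n" if "b \<in> U A n k" for b
        using that track by (fastforce simp: U_def iterate_union_def cells_meeting_def)
      show ?thesis
        unfolding k_def[symmetric]
        by (rule hausdorff_distance_abs_le[OF image(1)[OF A] U(1)[OF A n] nonneg AB BA])
    qed
    \<comment> \<open>The bound \<open>e n\<close> is uniform in \<open>s\<close>, so integration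
      only multiplies it by the length of the interval; the absolute value covers negative
      \<open>t\<close>.\<close>
    have "\<forall>\<^sub>F n in sequentially. norm (LBINT s=ereal (- t)..ereal t. ?D A n s) \<le> e n * \<bar>t - - t\<bar>"
      using eventually_ge_at_top[of 1]
    proof eventually_elim
      case (elim n)
      have "\<bar>LBINT s=ereal (- t)..ereal t. ?D A n s\<bar> \<le> e n * \<bar>t - - t\<bar>"
        using close[OF elim] by (intro interval_integral_abs_le integrable A elim) auto
      then show ?case by simp
    qed
    moreover have "(\<lambda>n. e n * \<bar>t - - t\<bar>) \<longlonglongrightarrow> 0" using e_lim by (rule tendsto_mult_left_zero)
    ultimately show ?thesis by (rule Lim_null_comparison)
  qed
  show ?thesis
    using \<sigma>(1) integrable lim unfolding periodic_approximation_def U_def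
    by (intro exI[of _ \<sigma>] conjI allI impI) simp_all
qed

end
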